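(* Let $\lambda\in\mathbb R$, let $\vec v\in\mathbb R^3$ be a unit vector, and let $\Sigma$ be a rotational surface in $\mathbb R^3$ about the axis $L$. If $\Sigma$ is a $\lambda$-translating soliton with density vector $\vec v$, then $\vec v$ and $L$ are parallel, or $\Sigma$ is a plane orthogonal to $L$ and $\vec v$.
   Context: A $\lambda$-translating soliton with density vector $\vec v$ ($|\vec v|=1$) is an orientable surface in $\mathbb R^3$ whose mean curvature $H$ satisfies $2H=2\lambda+\langle N,\vec v\rangle$ at every point, where $N$ is the Gauss map and $2H$ is the sum of the principal curvatures. A rotational surface about $L$ is a surface obtained by rotating a planar profile curve about $L$; when $L$ is the $z$-axis it is parametrized by $X(s,t)=(x(s)\cos t,x(s)\sin t,z(s))$, $s\in I$, $t\in\mathbb R$, with $x(s)>0$.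
   Formalization: The second alternative is corrected to: Σ lies in a plane orthogonal to L and 2λ+⟨N,v⟩=0 on Σ; "orthogonal to v" fails for λ=0, L the z-axis, v=e1, Σ the plane z=0 minus the origin. *)

theory Defs
  imports "HOL-Analysis.Analysis"
begin

text \<open>On an open set this is C-k regularity: with finite-dimensional domain, \<open>C_k_on k U f\<close> says
  that all iterated directional derivatives of order less than \<open>k\<close> are Frechet differentiable and
  those of order \<open>k\<close> are continuous.\<close>

primrec C_k_on ::
    "nat \<Rightarrow> 'a::real_normed_vector set \<Rightarrow> ('a \<Rightarrow> 'b::real_normed_vector) \<Rightarrow> bool" where
  "C_k_on 0 U f \<longleftrightarrow> continuous_on U f"
| "C_k_on (Suc k) U f \<longleftrightarrow>
     f differentiable_on U \<and> (\<forall>w. C_k_on k U (\<lambda>p. frechet_derivative f (at p) w))"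

definition smooth_on ::
    "'a::real_normed_vector set \<Rightarrow> ('a \<Rightarrow> 'b::real_normed_vector) \<Rightarrow> bool" where
  "smooth_on U f \<longleftrightarrow> (\<forall>k. C_k_on k U f)"

text \<open>Surfaces are immersed surfaces \<open>X\<close> in space, with parameter domain \<open>U\<close> in the plane; a
  Gauss map is a map on the parameter domain.\<close>

definition regular_surface :: "(real \<times> real) set \<Rightarrow> (real \<times> real \<Rightarrow> real ^ 3) \<Rightarrow> bool" where
  "regular_surface U X \<longleftrightarrow>
     open U \<and> smooth_on U X \<and> (\<forall>p\<in>U. inj (frechet_derivative X (at p)))"

definition gauss_map ::
    "(real \<times> real) set \<Rightarrow> (real \<times> real \<Rightarrow> real ^ 3) \<Rightarrow> (real \<times> real \<Rightarrow> real ^ 3) \<Rightarrow> bool" where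
  "gauss_map U X N \<longleftrightarrow>
     smooth_on U N \<and>
     (\<forall>p\<in>U. norm (N p) = 1 \<and> (\<forall>w. N p \<bullet> frechet_derivative X (at p) w = 0))"

text \<open>The principal curvatures, with multiplicity, are the eigenvalues of the shape operator
  \<open>- dN\<close>, which is diagonal in some orthonormal basis \<open>dX w\<^sub>1, dX w\<^sub>2\<close> of the tangent plane.\<close>

definition principal_curvatures ::
    "(real \<times> real \<Rightarrow> real ^ 3) \<Rightarrow> (real \<times> real \<Rightarrow> real ^ 3) \<Rightarrow> real \<times> real \<Rightarrow> real \<Rightarrow> real \<Rightarrow> bool"
  where
  "principal_curvatures X N p k\<^sub>1 k\<^sub>2 \<longleftrightarrow>
     (let dX = frechet_derivative X (at p); dN = frechet_derivative N (at p) in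
      \<exists>w\<^sub>1 w\<^sub>2. norm (dX w\<^sub>1) = 1 \<and> norm (dX w\<^sub>2) = 1 \<and> dX w\<^sub>1 \<bullet> dX w\<^sub>2 = 0 \<and>
        - dN w\<^sub>1 = k\<^sub>1 *\<^sub>R dX w\<^sub>1 \<and> - dN w\<^sub>2 = k\<^sub>2 *\<^sub>R dX w\<^sub>2)"

definition has_mean_curvature ::
    "(real \<times> real \<Rightarrow> real ^ 3) \<Rightarrow> (real \<times> real \<Rightarrow> real ^ 3) \<Rightarrow> real \<times> real \<Rightarrow> real \<Rightarrow> bool" where
  "has_mean_curvature X N p H \<longleftrightarrow> (\<exists>k\<^sub>1 k\<^sub>2. principal_curvatures X N p k\<^sub>1 k\<^sub>2 \<and> 2 * H = k\<^sub>1 + k\<^sub>2)"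

definition translating_soliton ::
    "real \<Rightarrow> real ^ 3 \<Rightarrow> (real \<times> real) set \<Rightarrow> (real \<times> real \<Rightarrow> real ^ 3) \<Rightarrow>
     (real \<times> real \<Rightarrow> real ^ 3) \<Rightarrow> bool" where
  "translating_soliton lam v U X N \<longleftrightarrow>
     regular_surface U X \<and> gauss_map U X N \<and>
     (\<forall>p\<in>U. \<exists>H. has_mean_curvature X N p H \<and> 2 * H = 2 * lam + N p \<bullet> v)"

definition line :: "real ^ 3 \<Rightarrow> real ^ 3 \<Rightarrow> (real ^ 3) set" where
  "line a d = {a + r *\<^sub>R d |r. True}"

definition parallel_to_line :: "real ^ 3 \<Rightarrow> (real ^ 3) set \<Rightarrow> bool" where
  "parallel_to_line v L \<longleftrightarrow> v \<noteq> 0 \<and> (\<exists>a. L = line a v)"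

definition plane_orthogonal_to :: "(real ^ 3) set \<Rightarrow> (real ^ 3) set \<Rightarrow> bool" where
  "plane_orthogonal_to P L \<longleftrightarrow> (\<exists>a d b. d \<noteq> 0 \<and> L = line a d \<and> P = {q. d \<bullet> q = b})"

text \<open>The frame \<open>e\<^sub>1, e\<^sub>2, d\<close> at \<open>a\<close> plays the role of the coordinate axes when the axis \<open>L\<close> is not
  the \<open>z\<close>-axis; the profile curve is \<open>s \<mapsto> a + x s *\<^sub>R e\<^sub>1 + z s *\<^sub>R d\<close>.\<close>

definition rotational_surface ::
    "(real ^ 3) set \<Rightarrow> real set \<Rightarrow> (real \<times> real \<Rightarrow> real ^ 3) \<Rightarrow> bool" where
  "rotational_surface L I X \<longleftrightarrow>
     open I \<and> is_interval I \<and> I \<noteq> {} \<and>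
     (\<exists>a e\<^sub>1 e\<^sub>2 d x z.
        norm e\<^sub>1 = 1 \<and> norm e\<^sub>2 = 1 \<and> norm d = 1 \<and> e\<^sub>1 \<bullet> e\<^sub>2 = 0 \<and> e\<^sub>1 \<bullet> d = 0 \<and> e\<^sub>2 \<bullet> d = 0 \<and>
        L = line a d \<and>
        (\<forall>s\<in>I. x s > 0) \<and>
        (\<forall>s\<in>I. \<forall>t. X (s, t) = a + (x s * cos t) *\<^sub>R e\<^sub>1 + (x s * sin t) *\<^sub>R e\<^sub>2 + z s *\<^sub>R d))"

end

theory Submission
  imports Defs
begin

text \<open>
  Let the axis have direction \<open>d\<close>, let \<open>\<rho> t\<close> be the horizontal unit vector at angle \<open>t\<close>, and let
  \<open>(x, z)\<close> be the profile curve. Along a parallel, where \<open>s\<close> is fixed and only \<open>t\<close> varies, rotation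
  symmetry forces the Gauss map to turn with the surface: \<open>N (s, t) = \<alpha> s *\<^sub>R \<rho> t + \<beta> s *\<^sub>R d\<close>
  (\<open>gauss_map_equivariant\<close>). The mean curvature is therefore a function of \<open>s\<close> alone
  (\<open>mean_curvature_eq\<close>), and the soliton equation \<open>2 * H = 2 * lam + N \<bullet> v\<close> shows that
  \<open>\<alpha> s * (\<rho> t \<bullet> v)\<close> does not depend on \<open>t\<close>.

  If \<open>\<alpha> s \<noteq> 0\<close> for a single \<open>s\<close>, then \<open>\<rho> t \<bullet> v\<close> is constant in \<open>t\<close>. As \<open>\<rho> t\<close> runs through a full
  circle, this makes \<open>v\<close> orthogonal to all horizontal directions, so \<open>v\<close> is \<open>d\<close> or \<open>- d\<close>. If
  \<open>\<alpha>\<close> vanishes identically, the normal is axial everywhere, so the height \<open>z\<close> is constant and the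
  surface lies in a plane orthogonal to the axis; its mean curvature is zero, which turns the
  soliton equation into \<open>2 * lam + N \<bullet> v = 0\<close>.

  Everything is done with first derivatives of \<open>X\<close> and \<open>N\<close>. The curvature enters as the trace of
  \<open>- dN\<close> in the orthogonal basis \<open>X\<^sub>s\<close>, \<open>X\<^sub>t\<close> of the tangent plane
  (\<open>trace_eq_sum_principal_curvatures\<close>), so no second derivative of the profile appears, and no
  sign of the unit normal has to be chosen.
\<close>

section \<open>Orthonormal frames and the trace of the shape operator\<close>

lemma orthonormal_frame_expand:
  fixes e\<^sub>1 e\<^sub>2 e\<^sub>3 w :: "real ^ 3"
  assumes "norm e\<^sub>1 = 1" "norm e\<^sub>2 = 1" "norm e\<^sub>3 = 1"
    and "e\<^sub>1 \<bullet> e\<^sub>2 = 0" "e\<^sub>1 \<bullet> e\<^sub>3 = 0" "e\<^sub>2 \<bullet> e\<^sub>3 = 0"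
  shows "w = (w \<bullet> e\<^sub>1) *\<^sub>R e\<^sub>1 + (w \<bullet> e\<^sub>2) *\<^sub>R e\<^sub>2 + (w \<bullet> e\<^sub>3) *\<^sub>R e\<^sub>3"
proof -
  have ne: "e\<^sub>1 \<noteq> e\<^sub>2" "e\<^sub>1 \<noteq> e\<^sub>3" "e\<^sub>2 \<noteq> e\<^sub>3"
    using assms by (auto simp: norm_eq_1)
  let ?B = "{e\<^sub>1, e\<^sub>2, e\<^sub>3}"
  have orth: "pairwise orthogonal ?B"
    using assms by (auto simp: pairwise_def orthogonal_def inner_commute)
  have "independent ?B"
    using assms by (intro pairwise_orthogonal_independent[OF orth]) auto
  moreover have "card ?B = DIM(real ^ 3)"
    using ne by simp
  ultimately have "UNIV \<subseteq> span ?B"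
    by (intro card_ge_dim_independent) auto
  then have "w \<in> span ?B"
    by blast
  then have "(\<Sum>e\<in>?B. (w \<bullet> e) *\<^sub>R e) = w"
    using assms by (intro orthonormal_basis_expand[OF orth]) auto
  then show ?thesis
    using ne by (simp add: add.assoc)
qed

text \<open>A real 2 by 2 matrix with \<open>A A\<^sup>T = 1\<close> also satisfies \<open>A\<^sup>T A = 1\<close>.\<close>

lemma orthonormal_rows_imp_orthonormal_columns:
  fixes a b c d :: real
  assumes "a\<^sup>2 + b\<^sup>2 = 1" "c\<^sup>2 + d\<^sup>2 = 1" "a * c + b * d = 0"
  shows "a\<^sup>2 + c\<^sup>2 = 1" "b\<^sup>2 + d\<^sup>2 = 1" "a * b + c * d = 0"
proof -
  have "c\<^sup>2 = c\<^sup>2 * (a\<^sup>2 + b\<^sup>2)" using assms(1) by simp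
  also have "\<dots> = (a * c)\<^sup>2 + b\<^sup>2 * c\<^sup>2" by (simp add: algebra_simps power2_eq_square)
  also have "a * c = - (b * d)" using assms(3) by simp
  also have "(- (b * d))\<^sup>2 + b\<^sup>2 * c\<^sup>2 = b\<^sup>2 * (c\<^sup>2 + d\<^sup>2)" by (simp add: algebra_simps power2_eq_square)
  finally have "c\<^sup>2 = b\<^sup>2" using assms(2) by simp
  then show "a\<^sup>2 + c\<^sup>2 = 1" "b\<^sup>2 + d\<^sup>2 = 1" using assms(1,2) by simp_all
  have "a * b + c * d = a * b * (c\<^sup>2 + d\<^sup>2) + c * d * (a\<^sup>2 + b\<^sup>2)" using assms(1,2) by simp
  also have "\<dots> = (a * c + b * d) * (b * c + a * d)" by (simp add: algebra_simps power2_eq_square)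
  finally show "a * b + c * d = 0" using assms(3) by simp
qed

text \<open>The trace of the shape operator is the same in every orthonormal basis of the tangent plane, so
  it can be read off in the normalised coordinate basis \<open>X\<^sub>s\<close>, \<open>X\<^sub>t\<close> instead of the principal
  directions. The matrix between the two bases is orthogonal, and orthogonality of its columns is
  what expresses the coordinate directions through the principal ones.\<close>

lemma trace_eq_sum_principal_curvatures:
  fixes X N :: "real \<times> real \<Rightarrow> real ^ 3" and p :: "real \<times> real"
  defines "X\<^sub>s \<equiv> frechet_derivative X (at p) (1, 0)" and "X\<^sub>t \<equiv> frechet_derivative X (at p) (0, 1)"
    and "N\<^sub>s \<equiv> frechet_derivative N (at p) (1, 0)" and "N\<^sub>t \<equiv> frechet_derivative N (at p) (0, 1)"
  assumes dX: "X differentiable at p" and dN: "N differentiable at p"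
    and orth: "X\<^sub>s \<bullet> X\<^sub>t = 0" and nz: "X\<^sub>s \<noteq> 0" "X\<^sub>t \<noteq> 0"
    and pc: "principal_curvatures X N p k\<^sub>1 k\<^sub>2"
  shows "k\<^sub>1 + k\<^sub>2 = - (N\<^sub>s \<bullet> X\<^sub>s / (X\<^sub>s \<bullet> X\<^sub>s) + N\<^sub>t \<bullet> X\<^sub>t / (X\<^sub>t \<bullet> X\<^sub>t))"
proof -
  have linX: "linear (frechet_derivative X (at p))" and linN: "linear (frechet_derivative N (at p))"
    using dX dN by (auto intro: linear_frechet_derivative)
  have split: "F (g, h) = g *\<^sub>R F (1, 0) + h *\<^sub>R F (0, 1)"
    if "linear F" for F :: "real \<times> real \<Rightarrow> real ^ 3" and g h
  proof -
    have "F (g, h) = F (g *\<^sub>R (1, 0) + h *\<^sub>R (0, 1))" by simp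
    also have "\<dots> = g *\<^sub>R F (1, 0) + h *\<^sub>R F (0, 1)"
      by (simp only: linear_add[OF that] linear_scale[OF that])
    finally show ?thesis .
  qed
  obtain a b c e where
    n1: "norm (a *\<^sub>R X\<^sub>s + b *\<^sub>R X\<^sub>t) = 1" and n2: "norm (c *\<^sub>R X\<^sub>s + e *\<^sub>R X\<^sub>t) = 1"
    and o12: "(a *\<^sub>R X\<^sub>s + b *\<^sub>R X\<^sub>t) \<bullet> (c *\<^sub>R X\<^sub>s + e *\<^sub>R X\<^sub>t) = 0"
    and k1: "- (a *\<^sub>R N\<^sub>s + b *\<^sub>R N\<^sub>t) = k\<^sub>1 *\<^sub>R (a *\<^sub>R X\<^sub>s + b *\<^sub>R X\<^sub>t)"
    and k2: "- (c *\<^sub>R N\<^sub>s + e *\<^sub>R N\<^sub>t) = k\<^sub>2 *\<^sub>R (c *\<^sub>R X\<^sub>s + e *\<^sub>R X\<^sub>t)"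
  proof -
    have dX_split: "frechet_derivative X (at p) (g, h) = g *\<^sub>R X\<^sub>s + h *\<^sub>R X\<^sub>t"
      and dN_split: "frechet_derivative N (at p) (g, h) = g *\<^sub>R N\<^sub>s + h *\<^sub>R N\<^sub>t" for g h
      using split[OF linX] split[OF linN] unfolding X\<^sub>s_def X\<^sub>t_def N\<^sub>s_def N\<^sub>t_def by blast+
    show thesis
      using pc that unfolding principal_curvatures_def Let_def split_paired_Ex dX_split dN_split
      by blast
  qed
  define E where "E = sqrt (X\<^sub>s \<bullet> X\<^sub>s)"
  define G where "G = sqrt (X\<^sub>t \<bullet> X\<^sub>t)"
  have E: "X\<^sub>s \<bullet> X\<^sub>s = E\<^sup>2" "E \<noteq> 0" and G: "X\<^sub>t \<bullet> X\<^sub>t = G\<^sup>2" "G \<noteq> 0"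
    using nz by (auto simp: E_def G_def)
  note inner_simps = inner_add_left inner_add_right inner_scaleR_left inner_scaleR_right
    inner_minus_left inner_commute[of X\<^sub>t X\<^sub>s] orth E(1) G(1)
  \<comment> \<open>The rows \<open>(a E, b G)\<close> and \<open>(c E, e G)\<close> are the coordinates of the principal directions in
    the basis \<open>X\<^sub>s / E\<close>, \<open>X\<^sub>t / G\<close>.\<close>
  have rows: "(a * E)\<^sup>2 + (b * G)\<^sup>2 = 1" "(c * E)\<^sup>2 + (e * G)\<^sup>2 = 1"
    "(a * E) * (c * E) + (b * G) * (e * G) = 0"
    using n1 n2 o12 by (simp_all add: norm_eq_1 inner_simps power2_eq_square algebra_simps)
  note cols = orthonormal_rows_imp_orthonormal_columns[OF rows]
  have p1: "a * (N\<^sub>s \<bullet> X\<^sub>s) + b * (N\<^sub>t \<bullet> X\<^sub>s) = - k\<^sub>1 * a * E\<^sup>2"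
    and p2: "c * (N\<^sub>s \<bullet> X\<^sub>s) + e * (N\<^sub>t \<bullet> X\<^sub>s) = - k\<^sub>2 * c * E\<^sup>2"
    and q1: "a * (N\<^sub>s \<bullet> X\<^sub>t) + b * (N\<^sub>t \<bullet> X\<^sub>t) = - k\<^sub>1 * b * G\<^sup>2"
    and q2: "c * (N\<^sub>s \<bullet> X\<^sub>t) + e * (N\<^sub>t \<bullet> X\<^sub>t) = - k\<^sub>2 * e * G\<^sup>2"
    using arg_cong[OF k1, of "\<lambda>u. u \<bullet> X\<^sub>s"] arg_cong[OF k2, of "\<lambda>u. u \<bullet> X\<^sub>s"]
      arg_cong[OF k1, of "\<lambda>u. u \<bullet> X\<^sub>t"] arg_cong[OF k2, of "\<lambda>u. u \<bullet> X\<^sub>t"]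
    by (simp_all add: inner_simps algebra_simps)
  have mixed: "a * b + c * e = 0"
  proof -
    have "(a * b + c * e) * (E * G) = 0" using cols(3) by (simp add: algebra_simps)
    then show ?thesis using E(2) G(2) by simp
  qed
  have inverse_sums: "a\<^sup>2 + c\<^sup>2 = 1 / E\<^sup>2" "b\<^sup>2 + e\<^sup>2 = 1 / G\<^sup>2"
    using cols(1,2) E(2) G(2)
    by (simp_all add: nonzero_eq_divide_eq distrib_right power_mult_distrib)
  \<comment> \<open>The combination with weights \<open>a\<close>, \<open>c\<close> eliminates the off-diagonal entry \<open>N\<^sub>t \<bullet> X\<^sub>s\<close>; in the
    same way, \<open>b\<close>, \<open>e\<close> will eliminate \<open>N\<^sub>s \<bullet> X\<^sub>t\<close>.\<close>
  have "(N\<^sub>s \<bullet> X\<^sub>s) * (a\<^sup>2 + c\<^sup>2) = a * (a * (N\<^sub>s \<bullet> X\<^sub>s) + b * (N\<^sub>t \<bullet> X\<^sub>s))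
      + c * (c * (N\<^sub>s \<bullet> X\<^sub>s) + e * (N\<^sub>t \<bullet> X\<^sub>s)) - (a * b + c * e) * (N\<^sub>t \<bullet> X\<^sub>s)"
    by (simp add: algebra_simps power2_eq_square)
  also have "\<dots> = - (k\<^sub>1 * (a * E)\<^sup>2 + k\<^sub>2 * (c * E)\<^sup>2)"
    unfolding p1 p2 mixed by (simp add: algebra_simps power2_eq_square)
  finally have s: "N\<^sub>s \<bullet> X\<^sub>s / E\<^sup>2 = - (k\<^sub>1 * (a * E)\<^sup>2 + k\<^sub>2 * (c * E)\<^sup>2)"
    using inverse_sums(1) by simp
  have "(N\<^sub>t \<bullet> X\<^sub>t) * (b\<^sup>2 + e\<^sup>2) = b * (a * (N\<^sub>s \<bullet> X\<^sub>t) + b * (N\<^sub>t \<bullet> X\<^sub>t))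
      + e * (c * (N\<^sub>s \<bullet> X\<^sub>t) + e * (N\<^sub>t \<bullet> X\<^sub>t)) - (a * b + c * e) * (N\<^sub>s \<bullet> X\<^sub>t)"
    by (simp add: algebra_simps power2_eq_square)
  also have "\<dots> = - (k\<^sub>1 * (b * G)\<^sup>2 + k\<^sub>2 * (e * G)\<^sup>2)"
    unfolding q1 q2 mixed by (simp add: algebra_simps power2_eq_square)
  finally have t: "N\<^sub>t \<bullet> X\<^sub>t / G\<^sup>2 = - (k\<^sub>1 * (b * G)\<^sup>2 + k\<^sub>2 * (e * G)\<^sup>2)"
    using inverse_sums(2) by simp
  have "k\<^sub>1 * (a * E)\<^sup>2 + k\<^sub>2 * (c * E)\<^sup>2 + (k\<^sub>1 * (b * G)\<^sup>2 + k\<^sub>2 * (e * G)\<^sup>2)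
      = k\<^sub>1 * ((a * E)\<^sup>2 + (b * G)\<^sup>2) + k\<^sub>2 * ((c * E)\<^sup>2 + (e * G)\<^sup>2)"
    by (simp only: distrib_left ac_simps)
  also have "\<dots> = k\<^sub>1 + k\<^sub>2"
    unfolding rows by simp
  finally have "k\<^sub>1 * (a * E)\<^sup>2 + k\<^sub>2 * (c * E)\<^sup>2 + (k\<^sub>1 * (b * G)\<^sup>2 + k\<^sub>2 * (e * G)\<^sup>2) = k\<^sub>1 + k\<^sub>2" .
  then show ?thesis
    using s t E(1) G(1) by simp
qed

section \<open>Partial derivatives\<close>

lemma has_vector_derivative_partials:
  fixes f :: "real \<times> real \<Rightarrow> 'a::real_normed_vector"
  assumes "f differentiable at (s, t)"
  shows "((\<lambda>s. f (s, t)) has_vector_derivative frechet_derivative f (at (s, t)) (1, 0)) (at s)"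
    and "((\<lambda>t. f (s, t)) has_vector_derivative frechet_derivative f (at (s, t)) (0, 1)) (at t)"
proof -
  have f: "(f has_derivative frechet_derivative f (at (s, t))) (at (s, t))"
    using assms frechet_derivative_works by blast
  have s: "((\<lambda>s. (s, t)) has_vector_derivative (1, 0)) (at s)"
    and t: "((\<lambda>t. (s, t)) has_vector_derivative (0, 1)) (at t)"
    by (intro has_vector_derivative_Pair has_vector_derivative_id has_vector_derivative_const)+
  show "((\<lambda>s. f (s, t)) has_vector_derivative frechet_derivative f (at (s, t)) (1, 0)) (at s)"
    using vector_derivative_diff_chain_within[OF s has_derivative_at_withinI[OF f]]
    by (simp add: o_def)
  show "((\<lambda>t. f (s, t)) has_vector_derivative frechet_derivative f (at (s, t)) (0, 1)) (at t)"
    using vector_derivative_diff_chain_within[OF t has_derivative_at_withinI[OF f]]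
    by (simp add: o_def)
qed

lemma smooth_on_imp_differentiable_at:
  assumes "smooth_on U f" "open U" "p \<in> U"
  shows "f differentiable at p"
proof -
  have "C_k_on (Suc 0) U f" using assms(1) unfolding smooth_on_def by blast
  then have "f differentiable_on U" by simp
  then have "f differentiable at p within U" using assms(3) unfolding differentiable_on_def by blast
  then show ?thesis by (simp only: at_within_open[OF assms(3,2)])
qed

section \<open>Surfaces of revolution\<close>

locale surface_of_revolution =
  fixes I :: "real set" and X N :: "real \<times> real \<Rightarrow> real ^ 3"
    and a e\<^sub>1 e\<^sub>2 d :: "real ^ 3" and x z :: "real \<Rightarrow> real"
  assumes I: "open I" "is_interval I"
    and frame: "norm e\<^sub>1 = 1" "norm e\<^sub>2 = 1" "norm d = 1" "e\<^sub>1 \<bullet> e\<^sub>2 = 0" "e\<^sub>1 \<bullet> d = 0" "e\<^sub>2 \<bullet> d = 0"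
    and x_pos: "\<And>s. s \<in> I \<Longrightarrow> x s > 0"
    and X_eq: "\<And>s t. s \<in> I \<Longrightarrow> 
      X (s, t) = a + (x s * cos t) *\<^sub>R e\<^sub>1 + (x s * sin t) *\<^sub>R e\<^sub>2 + z s *\<^sub>R d"
    and regular: "regular_surface (I \<times> UNIV) X"
    and gauss: "gauss_map (I \<times> UNIV) X N"
begin

text \<open>Cylindrical frame: \<open>\<rho> t\<close>, \<open>\<tau> t\<close> and \<open>d\<close> are the radial, angular and axial unit vectors at
  angle \<open>t\<close>.\<close>

definition \<rho> :: "real \<Rightarrow> real ^ 3" where "\<rho> t = cos t *\<^sub>R e\<^sub>1 + sin t *\<^sub>R e\<^sub>2"
definition \<tau> :: "real \<Rightarrow> real ^ 3" where "\<tau> t = - sin t *\<^sub>R e\<^sub>1 + cos t *\<^sub>R e\<^sub>2"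

abbreviation "X\<^sub>s s t \<equiv> frechet_derivative X (at (s, t)) (1, 0)"
abbreviation "X\<^sub>t s t \<equiv> frechet_derivative X (at (s, t)) (0, 1)"
abbreviation "N\<^sub>s s t \<equiv> frechet_derivative N (at (s, t)) (1, 0)"
abbreviation "N\<^sub>t s t \<equiv> frechet_derivative N (at (s, t)) (0, 1)"

text \<open>Radial and axial components along the meridian \<open>t = 0\<close>, where \<open>\<rho> 0 = e\<^sub>1\<close>. The lemmas
  \<open>X\<^sub>s_eq\<close>, \<open>gauss_map_equivariant\<close> and \<open>N\<^sub>s_eq\<close> carry them to all other meridians.\<close>

definition x' :: "real \<Rightarrow> real" where "x' s = X\<^sub>s s 0 \<bullet> e\<^sub>1"
definition z' :: "real \<Rightarrow> real" where "z' s = X\<^sub>s s 0 \<bullet> d"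
definition \<alpha> :: "real \<Rightarrow> real" where "\<alpha> s = N (s, 0) \<bullet> e\<^sub>1"
definition \<beta> :: "real \<Rightarrow> real" where "\<beta> s = N (s, 0) \<bullet> d"
definition \<alpha>' :: "real \<Rightarrow> real" where "\<alpha>' s = N\<^sub>s s 0 \<bullet> e\<^sub>1"
definition \<beta>' :: "real \<Rightarrow> real" where "\<beta>' s = N\<^sub>s s 0 \<bullet> d"

lemma frame_inner [simp]:
  "e\<^sub>1 \<bullet> e\<^sub>1 = 1" "e\<^sub>2 \<bullet> e\<^sub>2 = 1" "d \<bullet> d = 1" "e\<^sub>1 \<bullet> e\<^sub>2 = 0" "e\<^sub>2 \<bullet> e\<^sub>1 = 0"
  "e\<^sub>1 \<bullet> d = 0" "d \<bullet> e\<^sub>1 = 0" "e\<^sub>2 \<bullet> d = 0" "d \<bullet> e\<^sub>2 = 0"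
  using frame by (auto simp: norm_eq_1 inner_commute)

lemma rotating_frame_inner [simp]:
  "\<rho> t \<bullet> \<rho> t = 1" "\<tau> t \<bullet> \<tau> t = 1" "\<rho> t \<bullet> \<tau> t = 0" "\<tau> t \<bullet> \<rho> t = 0"
  "\<rho> t \<bullet> d = 0" "d \<bullet> \<rho> t = 0" "\<tau> t \<bullet> d = 0" "d \<bullet> \<tau> t = 0"
  using sin_cos_squared_add3[of t]
  by (simp_all add: \<rho>_def \<tau>_def inner_add_left inner_add_right inner_diff_left inner_diff_right)

lemma \<rho>_0 [simp]: "\<rho> 0 = e\<^sub>1"
  by (simp add: \<rho>_def)

lemma \<rho>_derivative [derivative_intros]: "(\<rho> has_vector_derivative \<tau> t) (at t within T)"
  unfolding \<rho>_def[abs_def] \<tau>_def by (auto intro!: derivative_eq_intros)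

lemma rotating_frame_expand: "w = (w \<bullet> \<rho> t) *\<^sub>R \<rho> t + (w \<bullet> \<tau> t) *\<^sub>R \<tau> t + (w \<bullet> d) *\<^sub>R d"
  by (rule orthonormal_frame_expand) (auto simp: norm_eq_1)

lemma X_polar: "s \<in> I \<Longrightarrow> X (s, t) = a + x s *\<^sub>R \<rho> t + z s *\<^sub>R d"
  by (simp add: X_eq \<rho>_def algebra_simps)

lemma X_differentiable: "s \<in> I \<Longrightarrow> X differentiable at (s, t)"
  using regular I(1) by (intro smooth_on_imp_differentiable_at[of "I \<times> UNIV"])
    (auto simp: regular_surface_def)

lemma N_differentiable: "s \<in> I \<Longrightarrow> N differentiable at (s, t)"
  using gauss I(1) by (intro smooth_on_imp_differentiable_at[of "I \<times> UNIV"])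
    (auto simp: gauss_map_def open_Times)

text \<open>The functions \<open>x\<close> and \<open>z\<close> inherit their differentiability from \<open>X\<close>, whose coordinates they
  are along the meridian \<open>t = 0\<close>.\<close>

lemma profile_derivatives:
  assumes s: "s \<in> I"
  shows "(x has_vector_derivative x' s) (at s)" and "(z has_vector_derivative z' s) (at s)"
proof -
  have X: "((\<lambda>s. X (s, 0)) has_vector_derivative X\<^sub>s s 0) (at s)"
    using has_vector_derivative_partials(1)[OF X_differentiable[OF s]] .
  have "((\<lambda>s. (X (s, 0) - a) \<bullet> e\<^sub>1) has_vector_derivative x' s) (at s)"
    and "((\<lambda>s. (X (s, 0) - a) \<bullet> d) has_vector_derivative z' s) (at s)"
    unfolding x'_def z'_def
    by (auto intro!: derivative_eq_intros X 
        bounded_linear.has_vector_derivative[OF bounded_linear_inner_left])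
  then show "(x has_vector_derivative x' s) (at s)" and "(z has_vector_derivative z' s) (at s)"
    using s I(1) by (auto simp: X_polar inner_simps
        elim!: has_vector_derivative_transform_within_open)
qed

lemma X\<^sub>s_eq:
  assumes s: "s \<in> I"
  shows "X\<^sub>s s t = x' s *\<^sub>R \<rho> t + z' s *\<^sub>R d"
proof (rule vector_derivative_unique_at)
  show "((\<lambda>s. X (s, t)) has_vector_derivative X\<^sub>s s t) (at s)"
    using has_vector_derivative_partials(1)[OF X_differentiable[OF s]] .
  have "((\<lambda>s. a + x s *\<^sub>R \<rho> t + z s *\<^sub>R d) has_vector_derivative x' s *\<^sub>R \<rho> t + z' s *\<^sub>R d) (at s)"
    using profile_derivatives[OF s]
    by (auto intro!: derivative_eq_intros simp: has_real_derivative_iff_has_vector_derivative)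
  then show "((\<lambda>s. X (s, t)) has_vector_derivative x' s *\<^sub>R \<rho> t + z' s *\<^sub>R d) (at s)"
    by (rule has_vector_derivative_transform_within_open[OF _ I(1) s]) (simp add: X_polar)
qed

lemma X\<^sub>t_eq:
  assumes s: "s \<in> I"
  shows "X\<^sub>t s t = x s *\<^sub>R \<tau> t"
proof (rule vector_derivative_unique_at)
  show "((\<lambda>t. X (s, t)) has_vector_derivative X\<^sub>t s t) (at t)"
    using has_vector_derivative_partials(2)[OF X_differentiable[OF s]] .
  show "((\<lambda>t. X (s, t)) has_vector_derivative x s *\<^sub>R \<tau> t) (at t)"
    unfolding X_polar[OF s] by (auto intro!: derivative_eq_intros)
qed

lemma profile_regular:
  assumes s: "s \<in> I"
  shows "X\<^sub>s s t \<noteq> 0" and "x' s \<noteq> 0 \<or> z' s \<noteq> 0"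
proof -
  show *: "X\<^sub>s s t \<noteq> 0" for t
  proof
    assume "X\<^sub>s s t = 0"
    moreover have "frechet_derivative X (at (s, t)) 0 = 0"
      by (rule linear_0[OF linear_frechet_derivative[OF X_differentiable[OF s]]])
    moreover have "inj (frechet_derivative X (at (s, t)))"
      using regular s by (auto simp: regular_surface_def)
    ultimately have "(1, 0) = (0 :: real \<times> real)" by (metis injD)
    then show False by (simp add: zero_prod_def)
  qed
  show "x' s \<noteq> 0 \<or> z' s \<noteq> 0"
    using *[of 0] by (auto simp: X\<^sub>s_eq[OF s])
qed

lemma gauss_map_equations:
  assumes s: "s \<in> I"
  shows "N (s, t) \<bullet> N (s, t) = 1" and "N (s, t) \<bullet> \<tau> t = 0"
    and "N (s, t) \<bullet> (x' s *\<^sub>R \<rho> t + z' s *\<^sub>R d) = 0"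
proof -
  have "norm (N (s, t)) = 1" and perp: "N (s, t) \<bullet> frechet_derivative X (at (s, t)) w = 0" for w
    using gauss s unfolding gauss_map_def by blast+
  then show "N (s, t) \<bullet> N (s, t) = 1" by (simp add: norm_eq_1)
  show "N (s, t) \<bullet> \<tau> t = 0"
    using perp[of "(0, 1)"] x_pos[OF s] by (simp add: X\<^sub>t_eq[OF s])
  show "N (s, t) \<bullet> (x' s *\<^sub>R \<rho> t + z' s *\<^sub>R d) = 0"
    using perp[of "(1, 0)"] by (simp add: X\<^sub>s_eq[OF s])
qed

lemma gauss_map_expand:
  assumes s: "s \<in> I"
  shows "N (s, t) = (N (s, t) \<bullet> \<rho> t) *\<^sub>R \<rho> t + (N (s, t) \<bullet> d) *\<^sub>R d"
  using rotating_frame_expand[of "N (s, t)" t] gauss_map_equations(2)[OF s, of t] by simp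

text \<open>Differentiating \<open>N \<bullet> N = 1\<close> and \<open>N \<bullet> X\<^sub>s = 0\<close> along a parallel, where \<open>X\<^sub>s\<close> varies only in the
  direction of \<open>\<tau>\<close>, to which \<open>N\<close> is orthogonal, shows that \<open>N\<^sub>t\<close> is orthogonal to \<open>N\<close> and to \<open>X\<^sub>s\<close>.
  These two span the plane of \<open>\<rho>\<close> and \<open>d\<close>.\<close>

lemma gauss_map_components_stationary:
  assumes s: "s \<in> I"
  shows "N\<^sub>t s t \<bullet> \<rho> t = 0" and "N\<^sub>t s t \<bullet> d = 0"
proof -
  define A where "A = N (s, t) \<bullet> \<rho> t"
  define B where "B = N (s, t) \<bullet> d"
  have N: "N (s, t) = A *\<^sub>R \<rho> t + B *\<^sub>R d"
    unfolding A_def B_def by (rule gauss_map_expand[OF s])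
  have dN: "((\<lambda>t. N (s, t)) has_vector_derivative N\<^sub>t s t) (at t)"
    using has_vector_derivative_partials(2)[OF N_differentiable[OF s]] .
  have prod: "N (s, t) \<bullet> w' + N\<^sub>t s t \<bullet> w t = 0"
    if "\<And>t. N (s, t) \<bullet> w t = c" and "(w has_vector_derivative w') (at t)" for w w' c
  proof -
    have "((\<lambda>t. N (s, t) \<bullet> w t) has_vector_derivative (N (s, t) \<bullet> w' + N\<^sub>t s t \<bullet> w t)) (at t)"
      by (rule bounded_bilinear.has_vector_derivative[OF bounded_bilinear_inner dN that(2)])
    then show ?thesis
      unfolding that(1) using has_vector_derivative_const vector_derivative_unique_at by blast
  qed
  have "A * (N\<^sub>t s t \<bullet> \<rho> t) + B * (N\<^sub>t s t \<bullet> d) = 0"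
    using prod[OF gauss_map_equations(1)[OF s] dN] by (simp add: N inner_simps inner_commute)
  moreover have "x' s * (N\<^sub>t s t \<bullet> \<rho> t) + z' s * (N\<^sub>t s t \<bullet> d) = 0"
  proof -
    have "((\<lambda>t. x' s *\<^sub>R \<rho> t + z' s *\<^sub>R d) has_vector_derivative x' s *\<^sub>R \<tau> t) (at t)"
      by (auto intro!: derivative_eq_intros)
    from prod[OF gauss_map_equations(3)[OF s] this] show ?thesis
      by (simp add: gauss_map_equations(2)[OF s] inner_simps)
  qed
  moreover have "A * x' s + B * z' s = 0"
    using gauss_map_equations(3)[OF s, of t] by (simp add: N inner_simps mult.commute)
  moreover have "A\<^sup>2 + B\<^sup>2 = 1"
    using gauss_map_equations(1)[OF s, of t] by (simp add: N inner_simps power2_eq_square)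
  \<comment> \<open>A linear system for \<open>(N\<^sub>t \<bullet> \<rho>, N\<^sub>t \<bullet> d)\<close>: its rows \<open>(A, B)\<close> and \<open>(x', z')\<close> are orthogonal and
    the first has length one, so its squared determinant is \<open>x'\<^sup>2 + z'\<^sup>2\<close>.\<close>
  ultimately have "(N\<^sub>t s t \<bullet> \<rho> t) * ((x' s)\<^sup>2 + (z' s)\<^sup>2) = 0"
    and "(N\<^sub>t s t \<bullet> d) * ((x' s)\<^sup>2 + (z' s)\<^sup>2) = 0"
    by algebra+
  moreover have "(x' s)\<^sup>2 + (z' s)\<^sup>2 \<noteq> 0"
    using profile_regular(2)[OF s] by (simp add: sum_power2_eq_zero_iff)
  ultimately show "N\<^sub>t s t \<bullet> \<rho> t = 0" and "N\<^sub>t s t \<bullet> d = 0" by auto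
qed

text \<open>Since \<open>N\<close> is orthogonal to \<open>\<tau> = \<rho>'\<close>, the derivative of \<open>N \<bullet> \<rho>\<close> in \<open>t\<close> is \<open>N\<^sub>t \<bullet> \<rho> = 0\<close>. Both
  components of \<open>N\<close> in the rotating frame are thus constant along parallels.\<close>

lemma gauss_map_equivariant:
  assumes s: "s \<in> I"
  shows "N (s, t) = \<alpha> s *\<^sub>R \<rho> t + \<beta> s *\<^sub>R d"
proof -
  have dN: "((\<lambda>t. N (s, t)) has_vector_derivative N\<^sub>t s t) (at t)" for t
    using has_vector_derivative_partials(2)[OF N_differentiable[OF s]] .
  have "((\<lambda>t. N (s, t) \<bullet> \<rho> t) has_vector_derivative (N (s, t) \<bullet> \<tau> t + N\<^sub>t s t \<bullet> \<rho> t)) (at t)"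
    and "((\<lambda>t. N (s, t) \<bullet> d) has_vector_derivative (N (s, t) \<bullet> 0 + N\<^sub>t s t \<bullet> d)) (at t)" for t
    by (intro bounded_bilinear.has_vector_derivative[OF bounded_bilinear_inner dN]
        \<rho>_derivative has_vector_derivative_const)+
  then have "((\<lambda>t. N (s, t) \<bullet> \<rho> t) has_vector_derivative 0) (at t)"
    and "((\<lambda>t. N (s, t) \<bullet> d) has_vector_derivative 0) (at t)" for t
    by (simp_all add: gauss_map_equations(2)[OF s] gauss_map_components_stationary[OF s])
  then have "N (s, t) \<bullet> \<rho> t = N (s, 0) \<bullet> \<rho> 0" and "N (s, t) \<bullet> d = N (s, 0) \<bullet> d"
    using DERIV_isconst_all[of "\<lambda>t. N (s, t) \<bullet> \<rho> t" t 0]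
      DERIV_isconst_all[of "\<lambda>t. N (s, t) \<bullet> d" t 0]
    by (simp_all only: has_real_derivative_iff_has_vector_derivative simp_thms)
  then show ?thesis
    using gauss_map_expand[OF s, of t] by (simp add: \<alpha>_def \<beta>_def)
qed

lemma N\<^sub>s_eq:
  assumes s: "s \<in> I"
  shows "N\<^sub>s s t = \<alpha>' s *\<^sub>R \<rho> t + \<beta>' s *\<^sub>R d"
proof (rule vector_derivative_unique_at)
  have N: "((\<lambda>s. N (s, t)) has_vector_derivative N\<^sub>s s t) (at s)" for t
    using has_vector_derivative_partials(1)[OF N_differentiable[OF s]] .
  show "((\<lambda>s. N (s, t)) has_vector_derivative N\<^sub>s s t) (at s)" by (rule N)
  have "(\<alpha> has_vector_derivative \<alpha>' s) (at s)" and "(\<beta> has_vector_derivative \<beta>' s) (at s)"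
    unfolding \<alpha>_def[abs_def] \<beta>_def[abs_def] \<alpha>'_def \<beta>'_def
    by (intro bounded_linear.has_vector_derivative[OF bounded_linear_inner_left] N)+
  then have "((\<lambda>s. \<alpha> s *\<^sub>R \<rho> t + \<beta> s *\<^sub>R d) has_vector_derivative \<alpha>' s *\<^sub>R \<rho> t + \<beta>' s *\<^sub>R d) (at s)"
    by (auto intro!: derivative_eq_intros simp: has_real_derivative_iff_has_vector_derivative)
  then show "((\<lambda>s. N (s, t)) has_vector_derivative \<alpha>' s *\<^sub>R \<rho> t + \<beta>' s *\<^sub>R d) (at s)"
    by (rule has_vector_derivative_transform_within_open[OF _ I(1) s])
      (simp add: gauss_map_equivariant)
qed

lemma N\<^sub>t_eq:
  assumes s: "s \<in> I"
  shows "N\<^sub>t s t = \<alpha> s *\<^sub>R \<tau> t"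
proof (rule vector_derivative_unique_at)
  show "((\<lambda>t. N (s, t)) has_vector_derivative N\<^sub>t s t) (at t)"
    using has_vector_derivative_partials(2)[OF N_differentiable[OF s]] .
  show "((\<lambda>t. N (s, t)) has_vector_derivative \<alpha> s *\<^sub>R \<tau> t) (at t)"
    unfolding gauss_map_equivariant[OF s] by (auto intro!: derivative_eq_intros)
qed

text \<open>The point is that the right-hand side does not contain \<open>t\<close>. Its two summands are, up to sign,
  the normal curvatures of the meridian and of the parallel.\<close>

lemma mean_curvature_eq:
  assumes s: "s \<in> I" and H: "has_mean_curvature X N (s, t) H"
  shows "2 * H = - ((\<alpha>' s * x' s + \<beta>' s * z' s) / ((x' s)\<^sup>2 + (z' s)\<^sup>2) + \<alpha> s / x s)"
proof -
  obtain k\<^sub>1 k\<^sub>2 where k: "principal_curvatures X N (s, t) k\<^sub>1 k\<^sub>2" and "2 * H = k\<^sub>1 + k\<^sub>2"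
    using H by (auto simp: has_mean_curvature_def)
  moreover have "X\<^sub>s s t \<bullet> X\<^sub>t s t = 0"
    by (simp add: X\<^sub>s_eq[OF s] X\<^sub>t_eq[OF s] inner_simps)
  moreover have "X\<^sub>t s t \<noteq> 0"
    using x_pos[OF s] rotating_frame_inner(2)[of t]
    unfolding X\<^sub>t_eq[OF s] scaleR_eq_0_iff by (metis inner_zero_left less_irrefl zero_neq_one)
  ultimately have "2 * H = - (N\<^sub>s s t \<bullet> X\<^sub>s s t / (X\<^sub>s s t \<bullet> X\<^sub>s s t)
      + N\<^sub>t s t \<bullet> X\<^sub>t s t / (X\<^sub>t s t \<bullet> X\<^sub>t s t))"
    using trace_eq_sum_principal_curvatures[OF X_differentiable[OF s] N_differentiable[OF s]
        _ profile_regular(1)[OF s] _ k] by simp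
  then show ?thesis
    using x_pos[OF s]
    by (simp add: X\<^sub>s_eq[OF s] X\<^sub>t_eq[OF s] N\<^sub>s_eq[OF s] N\<^sub>t_eq[OF s] inner_simps power2_eq_square)
qed

text \<open>A unit normal without radial component is \<open>d\<close> or \<open>- d\<close>, so the tangent vector of the profile
  curve has no axial component.\<close>

lemma horizontal_if_normal_axial:
  assumes \<alpha>: "\<And>s. s \<in> I \<Longrightarrow> \<alpha> s = 0"
  shows "\<exists>c. \<forall>s\<in>I. z s = c" and "\<And>s. s \<in> I \<Longrightarrow> \<alpha>' s = 0" and "\<And>s. s \<in> I \<Longrightarrow> z' s = 0"
proof -
  have \<beta>: "(\<beta> s)\<^sup>2 = 1" if "s \<in> I" for s
    using gauss_map_equations(1)[OF that, of 0] \<alpha>[OF that]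
    by (simp add: gauss_map_equivariant[OF that] inner_simps power2_eq_square)
  show z': "z' s = 0" if "s \<in> I" for s
    using gauss_map_equations(3)[OF that, of 0] \<alpha>[OF that] \<beta>[OF that]
    by (auto simp: gauss_map_equivariant[OF that] inner_simps)
  show "\<alpha>' s = 0" if s: "s \<in> I" for s
  proof (rule vector_derivative_unique_at)
    show "(\<alpha> has_vector_derivative \<alpha>' s) (at s)"
      unfolding \<alpha>_def[abs_def] \<alpha>'_def
      by (intro bounded_linear.has_vector_derivative[OF bounded_linear_inner_left]
          has_vector_derivative_partials(1)[OF N_differentiable[OF s]])
    show "(\<alpha> has_vector_derivative 0) (at s)"
      by (rule has_vector_derivative_transform_within_open[OF has_vector_derivative_const I(1) s])
        (simp add: \<alpha>)
  qed
  have "convex I" using I(2) by (simp add: is_interval_convex)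
  moreover have "(z has_vector_derivative 0) (at s within I)" if "s \<in> I" for s
    using profile_derivatives(2)[OF that] z'[OF that] has_vector_derivative_at_within by fastforce
  ultimately show "\<exists>c. \<forall>s\<in>I. z s = c"
    using has_vector_derivative_zero_constant[of I z] by metis
qed

text \<open>At a parameter with \<open>\<alpha> s \<noteq> 0\<close>, only \<open>\<rho> t \<bullet> v\<close> in the soliton equation could depend on \<open>t\<close>.
  The angles \<open>pi\<close> and \<open>pi / 2\<close>, compared with \<open>0\<close>, make \<open>v\<close> orthogonal to \<open>e\<^sub>1\<close> and to \<open>e\<^sub>2\<close>.\<close>

lemma axis_direction_or_normal_axial:
  assumes soliton: "\<And>s t. s \<in> I \<Longrightarrow>
      \<exists>H. has_mean_curvature X N (s, t) H \<and> 2 * H = 2 * lam + N (s, t) \<bullet> v"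
    and v: "norm v = 1"
  shows "v = d \<or> v = - d \<or> (\<forall>s\<in>I. \<alpha> s = 0)"
proof (cases "\<forall>s\<in>I. \<alpha> s = 0")
  case False
  then obtain s where s: "s \<in> I" "\<alpha> s \<noteq> 0" by blast
  have rho: "\<rho> t \<bullet> v = \<rho> 0 \<bullet> v" for t
  proof -
    have "N (s, t) \<bullet> v = N (s, 0) \<bullet> v"
      using soliton[OF s(1)] mean_curvature_eq[OF s(1)] by (smt (verit))
    then show ?thesis using s by (simp add: gauss_map_equivariant inner_simps)
  qed
  have "e\<^sub>1 \<bullet> v = 0" using rho[of pi] by (simp add: \<rho>_def inner_simps)
  moreover have "e\<^sub>2 \<bullet> v = e\<^sub>1 \<bullet> v" using rho[of "pi / 2"] by (simp add: \<rho>_def inner_simps)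
  ultimately have v_eq: "v = (v \<bullet> d) *\<^sub>R d"
    using orthonormal_frame_expand[OF frame, of v] by (simp add: inner_commute)
  then have "\<bar>v \<bullet> d\<bar> = 1"
    using v frame(3) by (metis mult.right_neutral norm_scaleR)
  then show ?thesis using v_eq by (metis abs_eq_iff abs_1 scaleR_minus1_left scaleR_one)
qed auto

end

section \<open>Rotational translating solitons\<close>

theorem proposition4p3:
  fixes lam :: real and v :: "real ^ 3" and L :: "(real ^ 3) set" and I :: "real set"
    and X N :: "real \<times> real \<Rightarrow> real ^ 3"
  assumes "norm v = 1"
    and "rotational_surface L I X"
    and "translating_soliton lam v (I \<times> UNIV) X N"
  shows "parallel_to_line v L \<or>
    (\<exists>P. plane_orthogonal_to P L \<and> X ` (I \<times> UNIV) \<subseteq> P \<and>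
         (\<forall>p\<in>I \<times> UNIV. 2 * lam + N p \<bullet> v = 0))"
proof -
  obtain a e\<^sub>1 e\<^sub>2 d x z where L: "L = line a d" and "surface_of_revolution I X N a e\<^sub>1 e\<^sub>2 d x z"
    using assms(2,3) unfolding rotational_surface_def translating_soliton_def
      surface_of_revolution_def by blast
  then interpret surface_of_revolution I X N a e\<^sub>1 e\<^sub>2 d x z by simp
  have soliton: "\<exists>H. has_mean_curvature X N (s, t) H \<and> 2 * H = 2 * lam + N (s, t) \<bullet> v"
    if "s \<in> I" for s t
    using assms(3) that by (auto simp: translating_soliton_def)
  consider "v = d" | "v = - d" | "\<forall>s\<in>I. \<alpha> s = 0"
    using axis_direction_or_normal_axial[OF soliton assms(1)] by blast
  then show ?thesis
  proof cases
    case 1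
    then show ?thesis using L frame(3) by (auto simp: parallel_to_line_def)
  next
    case 2
    \<comment> \<open>A line has two unit direction vectors, and parallelism is insensitive to the choice.\<close>
    have "line a d = line a (- d)"
      unfolding line_def by (auto, metis scaleR_minus_left scaleR_minus_right minus_minus,
          metis scaleR_minus_left)
    then show ?thesis using 2 L frame(3) by (auto simp: parallel_to_line_def)
  next
    case 3
    obtain c where c: "\<And>s. s \<in> I \<Longrightarrow> z s = c"
      using horizontal_if_normal_axial(1) 3 by blast
    let ?P = "{q. d \<bullet> q = d \<bullet> a + c}"
    have "plane_orthogonal_to ?P L"
      using L frame(3) unfolding plane_orthogonal_to_def by (metis norm_zero zero_neq_one)
    moreover have "X ` (I \<times> UNIV) \<subseteq> ?P"
      by (auto simp: X_polar c inner_simps)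
    moreover have "2 * lam + N p \<bullet> v = 0" if p_in: "p \<in> I \<times> UNIV" for p
    proof -
      obtain s t where p: "p = (s, t)" and s: "s \<in> I" using p_in by blast
      obtain H where H: "has_mean_curvature X N (s, t) H" "2 * H = 2 * lam + N (s, t) \<bullet> v"
        using soliton[OF s] by blast
      moreover have "2 * H = 0"
        unfolding mean_curvature_eq[OF s H(1)] using 3 s horizontal_if_normal_axial(2,3) by simp
      ultimately show ?thesis using p by simp
    qed
    ultimately show ?thesis by blast
  qed
qed

end
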